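(* Let $P,Q\in\mathbb{Z}[x]$ be polynomials of degree at most $3$, $\mathcal{F}_k:y^2=P(x)k+Q(x)$, and let $q$ be a prime power with $2\nmid q$. Then $$\#M(\mathbb{F}_q)=q^3+q^2-q\,\#\Delta(\mathbb{F}_q)+q\,\#C(\mathbb{F}_q)+q\Big[\sum_{x\in\mathbb{F}_q,\,P(x)=0}\phi_q(Q(x))\Big]^2.$$ In particular $$\tilde{M}_{2,q}(\mathcal{F}_k)=q\Big(-\#\Delta(\mathbb{F}_q)+\#C(\mathbb{F}_q)+\Big[\sum_{x\in\mathbb{F}_q,\,P(x)=0}\phi_q(Q(x))\Big]^2\Big).$$
   Context: For $q=p^r$ the polynomials are reduced mod $p$. $\phi_q$ is the unique character of order $2$ of $\mathbb{F}_q^\times$, extended by $\phi_q(0)=0$. $\Delta(x_1,x_2)=P(x_1)Q(x_2)-P(x_2)Q(x_1)$, $\Delta(\mathbb{F}_q)=\{(x_1,x_2)\in\mathbb{F}_q^2:\Delta(x_1,x_2)=0\}$, and $C(\mathbb{F}_q)=\{(x_1,x_2,y)\in\mathbb{F}_q^3: P(x_1)P(x_2)=y^2,\ \Delta(x_1,x_2)=0\}$. For $k\in\mathbb{F}_q$, $a_{k,q}=q-\#\{(x,y)\in\mathbb{F}_q^2: y^2=P(x)k+Q(x)\}$, $a_{\infty,q}=q-\#\{(x,y)\in\mathbb{F}_q^2:y^2=P(x)\}$, and $\tilde{M}_{2,q}(\mathcal{F}_k)=\sum_{k\in\mathbb{F}_q}a_{k,q}^2+a_{\infty,q}^2$. Finally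 $\#M(\mathbb{F}_q)=\#\{(x_1,x_2,k,y)\in\mathbb{F}_q^4:(P(x_1)k+Q(x_1))(P(x_2)k+Q(x_2))=y^2\}+\#\{(x_1,x_2,y)\in\mathbb{F}_q^3:P(x_1)P(x_2)=y^2\}$. *)

theory Defs
  imports Complex_Main "HOL-Library.Cardinality" "HOL-Computational_Algebra.Polynomial"
    "HOL-Number_Theory.Prime_Powers"
begin

text \<open>
  The field with \<open>q\<close> elements is a type \<open>'a :: {field, finite}\<close> with \<open>CARD('a) = q\<close>. Except for
  \<open>reduction\<close>, the definitions below take polynomials that already have their coefficients in
  this field.
\<close>

definition reduction :: "int poly \<Rightarrow> 'a :: field poly" where
  "reduction P = map_poly of_int P"

text \<open>A homomorphism from the unit group to the nonzero complex numbers, extended by 0 at 0.\<close>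

definition mult_character :: "('a :: field \<Rightarrow> complex) \<Rightarrow> bool" where
  "mult_character \<chi> \<longleftrightarrow> \<chi> 0 = 0 \<and> (\<forall>x. x \<noteq> 0 \<longrightarrow> \<chi> x \<noteq> 0) \<and>
     (\<forall>x y. x \<noteq> 0 \<longrightarrow> y \<noteq> 0 \<longrightarrow> \<chi> (x * y) = \<chi> x * \<chi> y)"

text \<open>The order as an element of the group of characters under pointwise multiplication.\<close>

definition character_order :: "('a :: field \<Rightarrow> complex) \<Rightarrow> nat" where
  "character_order \<chi> = (LEAST n. n > 0 \<and> (\<forall>x. x \<noteq> 0 \<longrightarrow> \<chi> x ^ n = 1))"

text \<open>
  The unit group is cyclic of order \<open>q - 1\<close>, so exactly one character of order 2 exists when \<open>q\<close>
  is odd. For even \<open>q\<close> there is none and the value is unspecified.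
\<close>

definition quadratic_character :: "'a :: {field, finite} \<Rightarrow> complex" where
  "quadratic_character = (THE \<chi>. mult_character \<chi> \<and> character_order \<chi> = 2)"

definition \<Delta> :: "'a :: field poly \<Rightarrow> 'a poly \<Rightarrow> 'a \<Rightarrow> 'a \<Rightarrow> 'a" where
  "\<Delta> P Q x1 x2 = poly P x1 * poly Q x2 - poly P x2 * poly Q x1"

definition \<Delta>_points :: "'a :: field poly \<Rightarrow> 'a poly \<Rightarrow> ('a \<times> 'a) set" where
  "\<Delta>_points P Q = {(x1, x2). \<Delta> P Q x1 x2 = 0}"

definition C_points :: "'a :: field poly \<Rightarrow> 'a poly \<Rightarrow> ('a \<times> 'a \<times> 'a) set" where
  "C_points P Q = {(x1, x2, y). poly P x1 * poly P x2 = y ^ 2 \<and> \<Delta> P Q x1 x2 = 0}"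

text \<open>
  The traces of the family \<open>y\<^sup>2 = P(x) k + Q(x)\<close>, for \<open>k\<close> in the field and for \<open>k = \<infinity>\<close>.
\<close>

definition trace_at :: "'a :: {field, finite} poly \<Rightarrow> 'a poly \<Rightarrow> 'a \<Rightarrow> int" where
  "trace_at P Q k = int CARD('a) - int (card {(x, y). y ^ 2 = poly P x * k + poly Q x})"

definition trace_at_infinity :: "'a :: {field, finite} poly \<Rightarrow> int" where
  "trace_at_infinity P = int CARD('a) - int (card {(x, y). y ^ 2 = poly P x})"

definition second_moment :: "'a :: {field, finite} poly \<Rightarrow> 'a poly \<Rightarrow> int" where
  "second_moment P Q = (\<Sum>k\<in>UNIV. trace_at P Q k ^ 2) + trace_at_infinity P ^ 2"

text \<open>\<open>#M\<close> is by definition the sum of two affine point counts, the second one over \<open>k = \<infinity>\<close>.\<close>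

definition card_M :: "'a :: {field, finite} poly \<Rightarrow> 'a poly \<Rightarrow> nat" where
  "card_M P Q =
     card {(x1, x2, k, y).
       (poly P x1 * k + poly Q x1) * (poly P x2 * k + poly Q x2) = y ^ 2} +
     card {(x1, x2, y). poly P x1 * poly P x2 = y ^ 2}"

end

theory Submission
  imports Defs "HOL-Number_Theory.Residues"
begin

text \<open>
  With \<open>\<eta>\<close> the integer valued quadratic character, each equation \<open>y\<^sup>2 = a\<close> has \<open>1 + \<eta>(a)\<close> solutions,
  so \<open>#M - q\<^sup>3 - q\<^sup>2\<close> and the second moment both equal
  \<open>\<Sum>\<^sub>k (\<Sum>\<^sub>x \<eta>(P(x) k + Q(x)))\<^sup>2 + (\<Sum>\<^sub>x \<eta>(P(x)))\<^sup>2\<close>. Expanding the squares leaves the sums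
  \<open>\<Sum>\<^sub>k \<eta>((a k + b) (c k + d))\<close>. If \<open>a\<close>, \<open>c\<close> and \<open>a d - b c\<close> are nonzero, the substitution
  \<open>k \<mapsto> (a k + b) / (c k + d)\<close>, which misses only the value \<open>a / c\<close>, shows that the sum is \<open>-\<eta>(a c)\<close>;
  the degenerate cases give the remaining terms of the formula.
\<close>

section \<open>Odd characteristic and the integer valued quadratic character\<close>

lemma two_neq_zero_if_odd_card:
  assumes "\<not> 2 dvd CARD('a :: {field, finite})"
  shows "(2 :: 'a) \<noteq> 0"
proof
  assume "(2 :: 'a) = 0"
  then have "CHAR('a) dvd 2"
    by (metis of_nat_eq_0_iff_char_dvd of_nat_numeral)
  then have "CHAR('a) = 2"
    using CHAR_not_1' [where ?'a = 'a] two_is_prime_nat by (metis prime_nat_iff One_nat_def)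
  with assms show False
    using CHAR_dvd_CARD [where ?'a = 'a] by simp
qed

text \<open>Integer values, rather than complex ones, make order arguments on \<open>int\<close>
  available; \<open>quadratic_character_eq_eta\<close> gives the link to the complex
  character.\<close>

definition eta :: "'a :: field \<Rightarrow> int" where
  "eta x = (if x = 0 then 0 else if \<exists>y. x = y ^ 2 then 1 else -1)"

lemma eta_0 [simp]: "eta 0 = 0"
  by (simp add: eta_def)

lemma eta_eq_0_iff [simp]: "eta x = 0 \<longleftrightarrow> x = 0"
  by (simp add: eta_def)

lemma eta_range: "eta x = 0 \<or> eta x = 1 \<or> eta x = -1"
  by (simp add: eta_def)

lemma eta_eq_1E:
  assumes "eta x = 1"
  obtains z where "x = z ^ 2" "z \<noteq> 0"
proof -
  from assms have "x \<noteq> 0" by auto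
  moreover have "\<exists>z. x = z ^ 2"
  proof (rule ccontr)
    assume "\<not> ?thesis"
    with assms show False by (simp add: eta_def split: if_splits)
  qed
  ultimately show ?thesis using that by force
qed

lemma eta_mult_square: "y \<noteq> 0 \<Longrightarrow> eta (x * y ^ 2) = eta (x :: 'a :: field)"
proof -
  assume y: "y \<noteq> 0"
  have "(\<exists>z. x * y ^ 2 = z ^ 2) \<longleftrightarrow> (\<exists>z. x = z ^ 2)"
  proof
    assume "\<exists>z. x * y ^ 2 = z ^ 2"
    then obtain z where "x * y ^ 2 = z ^ 2" by blast
    then have "x = (z / y) ^ 2" using y by (simp add: field_simps)
    then show "\<exists>z. x = z ^ 2" by blast
  qed (metis power_mult_distrib)
  with y show ?thesis by (simp add: eta_def)
qed

lemma card_roots_eq_eta: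
  assumes "(2 :: 'a :: {field, finite}) \<noteq> 0"
  shows "int (card {y. y ^ 2 = (a :: 'a)}) = 1 + eta a"
proof (cases "\<exists>z. a = z ^ 2")
  case True
  then obtain z where z: "a = z ^ 2" by blast
  then have S: "{y. y ^ 2 = a} = {z, - z}" by (auto simp: power2_eq_iff)
  show ?thesis
  proof (cases "z = 0")
    case False
    then have "z \<noteq> - z"
      using assms by (metis add.right_inverse mult_2 mult_eq_0_iff)
    then show ?thesis using S z False by (auto simp: eta_def)
  qed (use S z in simp)
next
  case False
  then have "{y. y ^ 2 = a} = {}" by auto
  moreover have "a \<noteq> 0" using False by (metis zero_power2)
  ultimately show ?thesis using False by (simp add: eta_def)
qed

lemma card_Collect_case_prod:
  "card {(x :: 'b :: finite, y :: 'c :: finite). R x y} = (\<Sum>x\<in>UNIV. card {y. R x y})"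
proof -
  have "{(x, y). R x y} = Sigma UNIV (\<lambda>x. {y. R x y})" by auto
  then show ?thesis by simp
qed

text \<open>Each \<open>y\<close> is a square root of exactly one \<open>x\<close>, so the counts
  \<open>1 + eta x\<close> add up to \<open>CARD('a)\<close>, which the ones alone already
  contribute.\<close>

lemma sum_eta:
  assumes "(2 :: 'a :: {field, finite}) \<noteq> 0"
  shows "(\<Sum>x\<in>UNIV. eta (x :: 'a)) = 0"
proof -
  have "{(x :: 'a, y). y ^ 2 = x} = (\<lambda>y. (y ^ 2, y)) ` UNIV" by auto
  then have "card {(x :: 'a, y). y ^ 2 = x} = CARD('a)"
    by (simp add: card_image inj_on_def)
  then have "(\<Sum>x\<in>UNIV. card {y. y ^ 2 = (x :: 'a)}) = CARD('a)"
    by (simp only: card_Collect_case_prod)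
  then have "(\<Sum>x\<in>UNIV. int (card {y. y ^ 2 = (x :: 'a)})) = int CARD('a)"
    by (simp only: of_nat_sum [symmetric])
  then show ?thesis by (simp add: card_roots_eq_eta [OF assms] sum.distrib)
qed

lemma sum_eta_affine:
  assumes "(2 :: 'a :: {field, finite}) \<noteq> 0" "c \<noteq> 0"
  shows "(\<Sum>x\<in>UNIV. eta (c * x + d :: 'a)) = 0"
proof -
  have "bij (\<lambda>x. c * x + d)"
    by (rule o_bij [where g = "\<lambda>x. (x - d) / c"]) (use assms in \<open>auto simp: fun_eq_iff\<close>)
  from sum.reindex_bij_betw [OF this, of eta] show ?thesis
    using sum_eta [OF assms(1)] by simp
qed

text \<open>Nonzero squares factor out by \<open>eta_mult_square\<close>. For two nonsquares the
  sign is forced by comparing \<open>eta a\<close> with \<open>eta (n * a)\<close>, both of which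
  sum to 0 over \<open>a\<close>.\<close>

lemma eta_mult:
  assumes "(2 :: 'a :: {field, finite}) \<noteq> 0"
  shows "eta (x * y :: 'a) = eta x * eta y"
proof -
  have square: "eta (x * y :: 'a) = eta x * eta y" if "eta y = 1" for x y
  proof -
    obtain z where "y = z ^ 2" "z \<noteq> 0"
        using \<open>eta y = 1\<close> by (rule eta_eq_1E)
    with that show ?thesis by (simp add: eta_mult_square)
  qed
  have nonsquare: "eta (n * m :: 'a) = 1" if n: "eta n = -1" and m: "eta m = -1" for n m
  proof -
    have n0: "n \<noteq> 0" using n by auto
    \<comment> \<open>Where \<open>eta a = 1\<close> the second term is -1; where
      \<open>eta a = -1\<close> it is at most 1.\<close>
    have le: "eta a + eta (n * a) \<le> 0" for a
      using eta_range [of a] eta_range [of "n * a"] square [of a n] n by fastforce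
    \<comment> \<open>These nonpositive terms sum to 0, so they all vanish.\<close>
    have "(\<Sum>a\<in>UNIV. eta a + eta (n * a)) = 0"
      using sum_eta [OF assms] sum_eta_affine [OF assms n0, of 0] by (simp add: sum.distrib)
    then have "(\<Sum>a\<in>UNIV. - (eta a + eta (n * a))) = 0" by (simp only: sum_negf)
    then have "- (eta m + eta (n * m)) = 0"
      using le by (subst (asm) sum_nonneg_eq_0_iff) (auto simp only: neg_0_le_iff_le finite UNIV_I)
    with m show ?thesis by simp
  qed
  show ?thesis
    using eta_range [of x] eta_range [of y] square [of y x] square [of x y] nonsquare [of x y]
    by (auto simp: mult.commute)
qed

text \<open>The arguments differ by the factor \<open>y ^ 2\<close>; for \<open>y = 0\<close> both
  sides are 0 by the convention \<open>x / 0 = 0\<close>.\<close>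

lemma eta_divide:
  assumes "(2 :: 'a :: {field, finite}) \<noteq> 0"
  shows "eta (x / y :: 'a) = eta (x * y)"
proof (cases "y = 0")
  case False
  then show ?thesis
    using eta_mult_square [of y "x / y"] by (simp add: power2_eq_square)
qed simp

section \<open>Sums over \<open>k\<close> of \<open>eta\<close> at products of two linear
  forms\<close>

lemma sum_eta_quadratic:
  assumes two: "(2 :: 'a :: {field, finite}) \<noteq> 0"
    and a: "a \<noteq> 0" and c: "c \<noteq> 0" and D: "a * d - c * b \<noteq> 0"
  shows "(\<Sum>k\<in>UNIV. eta ((a * k + b) * (c * k + d :: 'a))) = - eta (a * c)"
proof -
  let ?f = "\<lambda>k. (a * k + b) / (c * k + d)"
  let ?A = "{k. c * k + d \<noteq> 0}"
  have inj: "inj_on ?f ?A"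
  proof (rule inj_onI)
    fix k l assume "k \<in> ?A" "l \<in> ?A" "?f k = ?f l"
    then have "(a * k + b) * (c * l + d) = (a * l + b) * (c * k + d)"
      by (simp add: frac_eq_eq)
    then have "(a * d - c * b) * (k - l) = 0" by (simp add: algebra_simps)
    then show "k = l" using D by simp
  qed
  have "?A = UNIV - {- d / c}"
    using c by (auto simp: field_simps eq_neg_iff_add_eq_0)
  then have card: "card ?A = CARD('a) - 1" by (simp add: card_Diff_singleton)
  have "?f ` ?A \<subseteq> UNIV - {a / c}"
  proof
    fix z assume "z \<in> ?f ` ?A"
    then obtain k where k: "c * k + d \<noteq> 0" "z = ?f k" by blast
    have "z \<noteq> a / c"
    proof
      assume "z = a / c"
      then have "(a * k + b) * c = a * (c * k + d)" using k c by (simp add: frac_eq_eq)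
      then show False using D by (simp add: algebra_simps)
    qed
    then show "z \<in> UNIV - {a / c}" by simp
  qed
  \<comment> \<open>An injective image with \<open>CARD('a) - 1\<close> elements fills a set of that
    size.\<close>
  then have image: "?f ` ?A = UNIV - {a / c}"
    by (rule card_subset_eq [rotated]) (simp_all add: card_image [OF inj] card card_Diff_singleton)
  \<comment> \<open>At the pole \<open>- d / c\<close> the product is 0, so dropping it costs
    nothing.\<close>
  have "(\<Sum>k\<in>UNIV. eta ((a * k + b) * (c * k + d))) = (\<Sum>k\<in>?A. eta ((a * k + b) * (c * k + d)))"
    by (rule sum.mono_neutral_right) auto
  also have "\<dots> = (\<Sum>k\<in>?A. eta (?f k))" by (simp add: eta_divide [OF two])
  also have "\<dots> = (\<Sum>z\<in>UNIV - {a / c}. eta z)"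
    using sum.reindex [OF inj, of eta] by (simp add: image)
  also have "\<dots> = - eta (a / c)"
    using sum_eta [OF two] by (simp add: sum_diff1)
  finally show ?thesis by (simp add: eta_divide [OF two])
qed

text \<open>All cases are merged into one formula, shaped for \<open>a = P(x)\<close>,
  \<open>b = Q(x)\<close>, \<open>c = P(y)\<close>, \<open>d = Q(y)\<close>: the first condition
  becomes \<open>\<Delta> = 0\<close>, the last says that \<open>P\<close> vanishes at both
  points.\<close>

lemma sum_eta_linear_product:
  assumes two: "(2 :: 'a :: {field, finite}) \<noteq> 0"
  shows "(\<Sum>k\<in>UNIV. eta (a * k + b) * eta (c * k + d :: 'a)) =
    (if a * d - c * b = 0 then int CARD('a) * eta (a * c) else 0) - eta (a * c) +
    (if a = 0 \<and> c = 0 then int CARD('a) * (eta b * eta d) else 0)"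
proof -
  consider "a = 0" "c = 0" | "a = 0" "c \<noteq> 0" | "a \<noteq> 0" "c = 0"
    | "a \<noteq> 0" "c \<noteq> 0" "a * d - c * b \<noteq> 0" | "a \<noteq> 0" "c \<noteq> 0" "a * d - c * b = 0" by blast
  then show ?thesis
  proof cases
    case 2
    then show ?thesis
      using sum_eta_affine [OF two, of c d] by (simp flip: sum_distrib_left)
  next
    case 3
    then show ?thesis
      using sum_eta_affine [OF two, of a b] by (simp flip: sum_distrib_right)
  next
    case 4
    then show ?thesis
      using sum_eta_quadratic [OF two] by (simp add: eta_mult [OF two])
  next
    case 5
    \<comment> \<open>The two forms are proportional, so their product is \<open>a * c\<close> times
      a square that vanishes only at \<open>- b / a\<close>.\<close>
    have "eta (a * k + b) * eta (c * k + d) = (if k = - b / a then 0 else eta (a * c))" for k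
    proof -
      have "c * k + d = (c / a) * (a * k + b)"
        using 5 by (simp add: field_simps)
      moreover have "u * (c / a * u) = a * c * (u / a) ^ 2" for u
        using 5(1) by (simp add: power2_eq_square)
      ultimately have "eta (a * k + b) * eta (c * k + d) = eta (a * c * ((a * k + b) / a) ^ 2)"
        by (simp only: eta_mult [OF two, symmetric])
      moreover have "a * k + b = 0 \<longleftrightarrow> k = - b / a"
        using 5(1) by (auto simp: field_simps eq_neg_iff_add_eq_0)
      ultimately show ?thesis
        using eta_mult_square [of "(a * k + b) / a" "a * c"] 5(1) by simp
    qed
    moreover have "(\<Sum>k\<in>UNIV. if k = - b / a then 0 else eta (a * c)) =
        (int CARD('a) - 1) * eta (a * c)"
      by (subst sum.If_cases) (simp_all add: Collect_neg_eq [symmetric] Compl_eq_Diff_UNIV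
          card_Diff_singleton of_nat_diff)
    ultimately show ?thesis using 5 by (simp add: algebra_simps)
  qed simp
qed

section \<open>The complex character of order 2\<close>

text \<open>Multiplication by \<open>x\<close> permutes the units, so the product of all values of
  \<open>\<chi>\<close> there, which is nonzero, absorbs this power. It gives the
  \<open>LEAST\<close> in \<open>character_order\<close> a witness.\<close>

lemma mult_character_power_CARD:
  fixes \<chi> :: "'a :: {field, finite} \<Rightarrow> complex"
  assumes "mult_character \<chi>" "x \<noteq> 0"
  shows "\<chi> x ^ (CARD('a) - 1) = 1"
proof -
  let ?U = "UNIV - {0 :: 'a}"
  have "bij_betw ((*) x) ?U ?U"
    by (rule bij_betwI [where g = "\<lambda>y. y / x"]) (use assms in auto)
  from prod.reindex_bij_betw [OF this, of \<chi>]
  have "(\<Prod>y\<in>?U. \<chi> y) = (\<Prod>y\<in>?U. \<chi> (x * y))" by simp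
  also have "\<dots> = (\<Prod>y\<in>?U. \<chi> x * \<chi> y)"
    using assms by (intro prod.cong) (auto simp: mult_character_def)
  also have "\<dots> = \<chi> x ^ (CARD('a) - 1) * (\<Prod>y\<in>?U. \<chi> y)"
    by (simp add: prod.distrib card_Diff_singleton)
  finally show ?thesis using assms by (auto simp: mult_character_def)
qed

text \<open>The definite description asks for existence and uniqueness: \<open>eta\<close> has order
  2, and any character of order 2 is 1 on nonzero squares and -1 on nonsquares.\<close>

lemma quadratic_character_eq_eta:
  assumes two: "(2 :: 'a :: {field, finite}) \<noteq> 0"
  shows "quadratic_character = (\<lambda>x :: 'a. of_int (eta x) :: complex)"
proof -
  let ?\<eta> = "\<lambda>x :: 'a. of_int (eta x) :: complex"
  \<comment> \<open>Otherwise a vanishing sum of nonnegative terms would contain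
    \<open>eta 1 = 1\<close>.\<close>
  have nonsquare: "\<exists>x :: 'a. eta x = -1"
  proof (rule ccontr)
    assume "\<not> ?thesis"
    then have "eta x \<ge> 0" for x :: 'a
      using eta_range [of x] by auto
    moreover have "(\<Sum>x\<in>UNIV. eta (x :: 'a)) = 0" by (rule sum_eta [OF two])
    ultimately have "eta (1 :: 'a) = 0" by (simp add: sum_nonneg_eq_0_iff)
    then show False by simp
  qed
  have char: "mult_character ?\<eta>" by (simp add: mult_character_def eta_mult [OF two])
  have order: "character_order ?\<eta> = 2"
    unfolding character_order_def
  proof (rule Least_equality)
    show "0 < (2 :: nat) \<and> (\<forall>x :: 'a. x \<noteq> 0 \<longrightarrow> ?\<eta> x ^ 2 = 1)" by (simp add: eta_def)
    fix n :: nat assume n: "0 < n \<and> (\<forall>x :: 'a. x \<noteq> 0 \<longrightarrow> ?\<eta> x ^ n = 1)"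
    obtain x :: 'a where x: "eta x = -1" using nonsquare by blast
    then have "x \<noteq> 0" by auto
    with n x have "(-1 :: complex) ^ n = 1" by fastforce
    then have "n \<noteq> 1" by auto
    with n show "2 \<le> n" by simp
  qed
  have unique: "\<chi> = ?\<eta>" if \<chi>: "mult_character \<chi>" and ord: "character_order \<chi> = 2" for \<chi>
  proof -
    let ?R = "\<lambda>n :: nat. n > 0 \<and> (\<forall>x. x \<noteq> 0 \<longrightarrow> \<chi> x ^ n = 1)"
    have mult: "\<chi> (x * y) = \<chi> x * \<chi> y" for x y
      using \<chi> unfolding mult_character_def by (cases "x = 0"; cases "y = 0") auto
    \<comment> \<open>Since 0 and 1 differ, \<open>CARD('a) - 1\<close> is a positive exponent;
      hence the least one exists, and it is 2.\<close>
    have "CARD('a) \<ge> card {0, 1 :: 'a}" by (intro card_mono) auto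
    then have "?R (CARD('a) - 1)" using mult_character_power_CARD [OF \<chi>] by simp
    then have "?R (LEAST n. ?R n)" by (rule LeastI)
    then have sq: "x \<noteq> 0 \<Longrightarrow> \<chi> x ^ 2 = 1" for x
      using ord by (simp add: character_order_def)
    have one: "\<chi> x = 1" if "eta x = 1" for x
    proof -
      obtain z where "x = z ^ 2" "z \<noteq> 0"
        using \<open>eta x = 1\<close> by (rule eta_eq_1E)
      then show ?thesis using sq [of z] mult [of z z] by (simp add: power2_eq_square)
    qed
    \<comment> \<open>Order 2 excludes the exponent 1, so some unit has a value other than 1; by
      \<open>one\<close> it is a nonsquare.\<close>
    obtain n where n0: "n \<noteq> 0" and n: "\<chi> n \<noteq> 1"
    proof -
      have "\<not> ?R 1"
        using ord not_less_Least [of 1 ?R] by (simp add: character_order_def)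
      then show ?thesis using that by auto
    qed
    have "\<chi> n = -1" using sq [OF n0] n by (simp add: power2_eq_1_iff)
    have "eta n = -1" using eta_range [of n] one n n0 by auto
    have neg: "\<chi> x = -1" if "eta x = -1" for x
    proof -
      \<comment> \<open>The product of two nonsquares is a nonzero square.\<close>
      have "\<chi> (x * n) = 1"
        by (rule one) (simp add: eta_mult [OF two] that \<open>eta n = -1\<close>)
      then show ?thesis by (simp add: mult \<open>\<chi> n = -1\<close> minus_equation_iff)
    qed
    show ?thesis
    proof
      fix x :: 'a
      consider "eta x = 0" | "eta x = 1" | "eta x = -1" using eta_range by blast
      then show "\<chi> x = ?\<eta> x"
        using \<chi> one neg by cases (auto simp: mult_character_def)
    qed
  qed
  show ?thesis
    unfolding quadratic_character_def using char order unique by blast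
qed

section \<open>Point counts, traces and the second moment\<close>

text \<open>The ones in \<open>1 + eta\<close> add up to \<open>CARD('a)\<close> and cancel in the
  trace.\<close>

lemma trace_at_eq_eta:
  assumes "(2 :: 'a :: {field, finite}) \<noteq> 0"
  shows "trace_at P Q (k :: 'a) = - (\<Sum>x\<in>UNIV. eta (poly P x * k + poly Q x))"
  by (simp add: trace_at_def card_Collect_case_prod card_roots_eq_eta [OF assms] sum.distrib)

lemma trace_at_infinity_eq_eta:
  assumes "(2 :: 'a :: {field, finite}) \<noteq> 0"
  shows "trace_at_infinity (P :: 'a poly) = - (\<Sum>x\<in>UNIV. eta (poly P x))"
  by (simp add: trace_at_infinity_def card_Collect_case_prod card_roots_eq_eta [OF assms]
      sum.distrib)

lemma sum_square_swap:
  fixes g :: "'b \<Rightarrow> 'c \<Rightarrow> int"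
  shows "(\<Sum>k\<in>K. (\<Sum>x\<in>A. g k x) ^ 2) = (\<Sum>x\<in>A. \<Sum>y\<in>A. \<Sum>k\<in>K. g k x * g k y)"
  unfolding power2_eq_square sum_product
  by (subst sum.swap, rule sum.cong [OF refl], rule sum.swap)

text \<open>The ones in \<open>1 + eta\<close> contribute \<open>q ^ 3\<close> over
  \<open>(x1, x2, k)\<close> and \<open>q ^ 2\<close> over \<open>(x1, x2)\<close>; the minus signs
  of the traces disappear on squaring.\<close>

lemma card_M_eq_second_moment:
  fixes P Q :: "'a :: {field, finite} poly"
  assumes two: "(2 :: 'a) \<noteq> 0"
  shows "int (card_M P Q) = int CARD('a) ^ 3 + int CARD('a) ^ 2 + second_moment P Q"
proof -
  have roots: "int (card {y. a = y ^ 2}) = 1 + eta a" for a :: 'a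
    using card_roots_eq_eta [OF two, of a] by (simp add: eq_commute)
  have infinity: "(\<Sum>x\<in>UNIV. eta (poly P x)) ^ 2 =
      (\<Sum>x\<in>UNIV. \<Sum>y\<in>UNIV. eta (poly P x * poly P y))"
    by (simp add: power2_eq_square sum_product eta_mult [OF two])
  have "second_moment P Q =
      (\<Sum>x\<in>UNIV. \<Sum>y\<in>UNIV. \<Sum>k\<in>UNIV. eta ((poly P x * k + poly Q x) * (poly P y * k + poly Q y))) +
      (\<Sum>x\<in>UNIV. \<Sum>y\<in>UNIV. eta (poly P x * poly P y))"
    by (simp add: second_moment_def trace_at_eq_eta [OF two] trace_at_infinity_eq_eta [OF two]
        infinity sum_square_swap) (simp add: eta_mult [OF two])
  then show ?thesis
    by (simp add: card_M_def card_Collect_case_prod roots sum.distrib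
        power2_eq_square [of "int CARD('a)"] power3_eq_cube)
qed

text \<open>Above a pair with \<open>\<Delta> = 0\<close> lie \<open>1 + eta\<close> values of
  \<open>y\<close>, above any other pair none; the ones count
  \<open>\<Delta>_points\<close>.\<close>

lemma card_C_points:
  fixes P Q :: "'a :: {field, finite} poly"
  assumes two: "(2 :: 'a) \<noteq> 0"
  shows "int (card (C_points P Q)) = int (card (\<Delta>_points P Q)) +
    (\<Sum>x\<in>UNIV. \<Sum>y\<in>UNIV. if \<Delta> P Q x y = 0 then eta (poly P x * poly P y) else 0)"
proof -
  have roots: "int (card {y. a = y ^ 2 \<and> R}) = (if R then 1 + eta a else 0)" for a :: 'a and R
    using card_roots_eq_eta [OF two, of a] by (simp add: eq_commute)
  have ind: "int (card {y :: 'a. \<Delta> P Q x y = 0}) = (\<Sum>y\<in>UNIV. if \<Delta> P Q x y = 0 then 1 else 0)" for x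
    by (simp add: sum.If_cases)
  show ?thesis
    unfolding C_points_def \<Delta>_points_def card_Collect_case_prod of_nat_sum roots ind
    by (simp flip: sum.distrib) (intro sum.cong refl, simp)
qed

lemma second_moment_eq:
  fixes P Q :: "'a :: {field, finite} poly"
  assumes two: "(2 :: 'a) \<noteq> 0"
  shows "second_moment P Q = int CARD('a) *
    (- int (card (\<Delta>_points P Q)) + int (card (C_points P Q)) +
      (\<Sum>x | poly P x = 0. eta (poly Q x)) ^ 2)"
proof -
  let ?q = "int CARD('a)"
  have "(\<Sum>k\<in>UNIV. (\<Sum>x\<in>UNIV. eta (poly P x * k + poly Q x)) ^ 2) =
      (\<Sum>x\<in>UNIV. \<Sum>y\<in>UNIV. \<Sum>k\<in>UNIV. eta (poly P x * k + poly Q x) * eta (poly P y * k + poly Q y))"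
    by (rule sum_square_swap)
  \<comment> \<open>Vanishing of \<open>P\<close> at both points is split into two separate factors,
    so that the last double sum becomes a square.\<close>
  also have "\<dots> = (\<Sum>x\<in>UNIV. \<Sum>y\<in>UNIV.
      ?q * (if \<Delta> P Q x y = 0 then eta (poly P x * poly P y) else 0) - eta (poly P x * poly P y) +
      ?q * ((if poly P x = 0 then eta (poly Q x) else 0) * (if poly P y = 0 then eta (poly Q y) else 0)))"
    by (intro sum.cong refl) (auto simp: sum_eta_linear_product [OF two] \<Delta>_def)
  \<comment> \<open>The middle sum enters as minus the square of the trace at infinity and cancels
    the term that \<open>second_moment\<close> adds.\<close>
  also have "\<dots> = ?q * (int (card (C_points P Q)) - int (card (\<Delta>_points P Q))) -
      (\<Sum>x\<in>UNIV. eta (poly P x)) ^ 2 +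
      ?q * (\<Sum>x\<in>UNIV. if poly P x = 0 then eta (poly Q x) else 0) ^ 2"
    by (simp only: sum.distrib sum_subtractf sum_distrib_left [symmetric] card_C_points [OF two]
        sum_distrib_right [symmetric] power2_eq_square eta_mult [OF two]) simp
  also have "(\<Sum>x\<in>UNIV. if poly P x = 0 then eta (poly Q x) else 0) =
      (\<Sum>x | poly P x = 0. eta (poly Q x))"
    by (simp add: sum.If_cases)
  finally show ?thesis
    by (simp add: second_moment_def trace_at_eq_eta [OF two] trace_at_infinity_eq_eta [OF two]
        algebra_simps)
qed

theorem theorem2p3:
  fixes P Q :: "int poly" and q :: nat
    and Pq Qq :: "'a :: {field, finite} poly"
  assumes "degree P \<le> 3" and "degree Q \<le> 3"
    and "primepow q" and "\<not> 2 dvd q"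
    and "CARD('a) = q"
    and "Pq = reduction P" and "Qq = reduction Q"
  shows "((of_nat (card_M Pq Qq) :: complex) =
      of_nat q ^ 3 + of_nat q ^ 2
      - of_nat q * of_nat (card (\<Delta>_points Pq Qq))
      + of_nat q * of_nat (card (C_points Pq Qq))
      + of_nat q * (\<Sum>x | poly Pq x = 0. quadratic_character (poly Qq x)) ^ 2) \<and>
    ((of_int (second_moment Pq Qq) :: complex) =
      of_nat q * (- of_nat (card (\<Delta>_points Pq Qq)) + of_nat (card (C_points Pq Qq))
        + (\<Sum>x | poly Pq x = 0. quadratic_character (poly Qq x)) ^ 2))"
proof -
  have two: "(2 :: 'a) \<noteq> 0"
    using two_neq_zero_if_odd_card assms(4,5) by blast
  have "(\<Sum>x | poly Pq x = 0. quadratic_character (poly Qq x)) =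
      of_int (\<Sum>x | poly Pq x = 0. eta (poly Qq x))"
    by (simp add: quadratic_character_eq_eta [OF two])
  \<comment> \<open>Only \<open>q ^ 3 + q ^ 2\<close> separates the two claims, so the first follows
    from the second.\<close>
  moreover have "(of_nat (card_M Pq Qq) :: complex) =
      of_nat q ^ 3 + of_nat q ^ 2 + of_int (second_moment Pq Qq)"
    using arg_cong [OF card_M_eq_second_moment [OF two, of Pq Qq], of "of_int :: int \<Rightarrow> complex"]
    by (simp add: assms(5))
  ultimately show ?thesis
    by (simp add: second_moment_eq [OF two] assms(5) algebra_simps)
qed

end
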